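(* Let $P_\infty\boxtimes P_\infty$ be the infinite 2-dimensional diagonal grid. Then $\operatorname{gp}(P_\infty\boxtimes P_\infty)=4$.
   Context: $P_\infty$ is the two-way infinite path with vertices $v_i$, $i\in\mathbb{Z}$, where $v_i$ and $v_j$ are adjacent iff $|i-j|=1$. The Cartesian product $G\square H$ has vertex set $V(G)\times V(H)$, with $(g,h)$ and $(g',h')$ adjacent if either $g=g'$ and $hh'\in E(H)$, or $h=h'$ and $gg'\in E(G)$. The strong product $G\boxtimes H$ is obtained from $G\square H$ by adding, for every edge $gg'\in E(G)$ and every edge $hh'\in E(H)$, the edges $(g,h)(g',h')$ and $(g,h')(g',h)$. A geodesic of a graph is a shortest path. A set $S$ of vertices of a graph $G$ is a general position set if no three distinct vertices of $S$ lie on a common geodesic of $G$. The general position number $\operatorname{gp}(G)$ is the maximum cardinality of a general position set of $G$. *)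

theory Defs
  imports Main "HOL-Library.Extended_Nat"
begin

text \<open>
  Undirected graphs, possibly infinite; an edge is the unordered pair of its two ends.
\<close>

record 'a ugraph =
  verts :: "'a set"
  edges :: "'a set set"

definition adjacent :: "'a ugraph \<Rightarrow> 'a \<Rightarrow> 'a \<Rightarrow> bool" where
  "adjacent G u v \<longleftrightarrow> {u, v} \<in> edges G"

definition simple_graph :: "'a ugraph \<Rightarrow> bool" where
  "simple_graph G \<longleftrightarrow> (\<forall>e \<in> edges G. e \<subseteq> verts G \<and> card e = 2)"

text \<open>The vertex \<open>v\<^sub>i\<close> of the two-way infinite path is the integer \<open>i\<close>.\<close>

definition P_inf :: "int ugraph" where
  "P_inf = \<lparr> verts = UNIV, edges = {{i, j} | i j. \<bar>i - j\<bar> = 1} \<rparr>"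

definition cartesian_product :: "'a ugraph \<Rightarrow> 'b ugraph \<Rightarrow> ('a \<times> 'b) ugraph" where
  "cartesian_product G H =
     \<lparr> verts = verts G \<times> verts H,
       edges = {{(g, h), (g, h')} | g h h'. g \<in> verts G \<and> {h, h'} \<in> edges H}
             \<union> {{(g, h), (g', h)} | g g' h. h \<in> verts H \<and> {g, g'} \<in> edges G} \<rparr>"

definition strong_product :: "'a ugraph \<Rightarrow> 'b ugraph \<Rightarrow> ('a \<times> 'b) ugraph" where
  "strong_product G H =
     \<lparr> verts = verts (cartesian_product G H),
       edges = edges (cartesian_product G H)
             \<union> {{(g, h), (g', h')} | g g' h h'. {g, g'} \<in> edges G \<and> {h, h'} \<in> edges H}
             \<union> {{(g, h'), (g', h)} | g g' h h'. {g, g'} \<in> edges G \<and> {h, h'} \<in> edges H} \<rparr>"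

text \<open>A path is the nonempty list of its vertices; its length is \<open>length p - 1\<close>.\<close>

definition is_path :: "'a ugraph \<Rightarrow> 'a list \<Rightarrow> bool" where
  "is_path G p \<longleftrightarrow>
     p \<noteq> [] \<and> set p \<subseteq> verts G \<and> distinct p \<and> successively (adjacent G) p"

text \<open>Comparing numbers of vertices of paths is the same as comparing path lengths.\<close>

definition geodesic :: "'a ugraph \<Rightarrow> 'a list \<Rightarrow> bool" where
  "geodesic G p \<longleftrightarrow>
     is_path G p \<and>
     (\<forall>q. is_path G q \<and> hd q = hd p \<and> last q = last p \<longrightarrow> length p \<le> length q)"

definition general_position :: "'a ugraph \<Rightarrow> 'a set \<Rightarrow> bool" where
  "general_position G S \<longleftrightarrow>
     S \<subseteq> verts G \<and>
     \<not> (\<exists>x\<in>S. \<exists>y\<in>S. \<exists>z\<in>S. x \<noteq> y \<and> y \<noteq> z \<and> x \<noteq> z \<and>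
          (\<exists>p. geodesic G p \<and> {x, y, z} \<subseteq> set p))"

text \<open>
  Cardinality with value \<open>\<infinity>\<close> on infinite sets, since \<open>card\<close> is \<open>0\<close> on these.
\<close>

definition ecard :: "'a set \<Rightarrow> enat" where
  "ecard S = (if finite S then enat (card S) else \<infinity>)"

text \<open>
  The supremum is \<open>\<infinity>\<close> if there are infinite, or arbitrarily large finite, general position
  sets; a finite supremum is a maximum, see \<open>gp_eq_enat_iff\<close> below.
\<close>

definition gp :: "'a ugraph \<Rightarrow> enat" where
  "gp G = (SUP S \<in> {S. general_position G S}. ecard S)"

lemma general_position_empty: "general_position G {}"
  by (simp add: general_position_def)

lemma gp_eq_enat_iff:
  "gp G = enat n \<longleftrightarrow>
     (\<exists>S. general_position G S \<and> finite S \<and> card S = n) \<and>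
     (\<forall>S. general_position G S \<longrightarrow> finite S \<and> card S \<le> n)"
proof -
  let ?A = "ecard ` {S. general_position G S}"
  have ne: "?A \<noteq> {}"
    using general_position_empty by blast
  have eq: "ecard S = enat m \<longleftrightarrow> finite S \<and> card S = m" for S :: "'a set" and m
    by (simp add: ecard_def)
  have le: "ecard S \<le> enat m \<longleftrightarrow> finite S \<and> card S \<le> m" for S :: "'a set" and m
    by (simp add: ecard_def)
  have "gp G = enat n \<longleftrightarrow> enat n \<in> ?A \<and> (\<forall>x \<in> ?A. x \<le> enat n)" (is "_ \<longleftrightarrow> ?R")
  proof
    assume g: "gp G = enat n"
    then have ub: "\<forall>x \<in> ?A. x \<le> enat n"
      unfolding gp_def by (metis SUP_upper imageE)
    then have "finite ?A"
      by (meson finite_enat_bounded)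
    then have "Sup ?A \<in> ?A"
      using ne by (simp add: Sup_enat_def)
    with g ub show ?R
      by (simp add: gp_def)
  next
    assume ?R
    then show "gp G = enat n"
      unfolding gp_def by (meson Sup_least Sup_upper antisym)
  qed
  then show ?thesis
    by (auto simp: le image_iff) (metis eq)+
qed

lemma simple_graph_P_inf: "simple_graph P_inf"
proof -
  have "card {i, j} = 2" if "\<bar>i - j\<bar> = 1" for i j :: int
    using that by (subst card_2_iff) (metis abs_0 diff_self zero_neq_one)
  then show ?thesis
    by (auto simp: simple_graph_def P_inf_def)
qed

lemma adjacent_P_inf: "adjacent P_inf i j \<longleftrightarrow> \<bar>i - j\<bar> = 1"
  by (auto simp: adjacent_def P_inf_def doubleton_eq_iff)

lemma edges_strong_product_iff:
  "e \<in> edges (strong_product G H) \<longleftrightarrow>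
     (\<exists>g h h'. e = {(g, h), (g, h')} \<and> g \<in> verts G \<and> adjacent H h h') \<or>
     (\<exists>g g' h. e = {(g, h), (g', h)} \<and> h \<in> verts H \<and> adjacent G g g') \<or>
     (\<exists>g g' h h'. e = {(g, h), (g', h')} \<and> adjacent G g g' \<and> adjacent H h h') \<or>
     (\<exists>g g' h h'. e = {(g, h'), (g', h)} \<and> adjacent G g g' \<and> adjacent H h h')"
  by (simp add: adjacent_def strong_product_def cartesian_product_def disj_assoc)

lemma adjacent_commute: "adjacent G u v \<longleftrightarrow> adjacent G v u"
  by (simp add: adjacent_def insert_commute)

lemma adjacent_strong_product:
  assumes "(g, h) \<in> verts (strong_product G H)" "(g', h') \<in> verts (strong_product G H)"
  shows "adjacent (strong_product G H) (g, h) (g', h') \<longleftrightarrow>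
     g = g' \<and> adjacent H h h' \<or> h = h' \<and> adjacent G g g' \<or> adjacent G g g' \<and> adjacent H h h'"
    (is "?L \<longleftrightarrow> ?R")
proof
  assume ?L
  then show ?R
    by (auto simp: adjacent_def[of "strong_product G H"] edges_strong_product_iff
        doubleton_eq_iff adjacent_commute)
next
  have "g \<in> verts G" "h \<in> verts H"
    using assms by (simp_all add: strong_product_def cartesian_product_def)
  moreover assume ?R
  ultimately show ?L
    unfolding adjacent_def[of "strong_product G H"] edges_strong_product_iff by metis
qed

end

theory Submission
  imports Defs
begin

text \<open>
  In the diagonal grid one moves like a chess king, so the distance of two vertices is the larger
  of their two coordinate differences.  For a coordinate \<open>h\<close> write \<open>x \<sqsubseteq>\<^sub>h y\<close> if that maximum
  is attained as \<open>h y - h x\<close>, that is, if \<open>y\<close> lies in the closed quarter-plane cone with apex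
  \<open>x\<close> opening in the positive \<open>h\<close> direction.  These cones give two partial orders, one for
  each coordinate, with two decisive properties: any two vertices are comparable in at least one
  of them (\<open>cone_comparable\<close>), and every chain of three vertices lies on a common geodesic
  (\<open>cone_chain_on_geodesic\<close>), because distances add up along a chain.

  The upper bound is then the argument of Erdos and Szekeres.  Mark each vertex \<open>p\<close> of a general
  position set by two bits, saying for each of the two orders whether another vertex of the set
  lies below \<open>p\<close>.  If distinct \<open>p\<close>, \<open>q\<close> had the same bits and, say, \<open>p\<close> were below \<open>q\<close> in
  one order, then the bit of \<open>q\<close> for this order would be set, hence also that of \<open>p\<close>, and
  \<open>r \<sqsubseteq> p \<sqsubseteq> q\<close> would be a chain of three.  So the marking is injective into a set with four
  elements; in particular infinite general position sets are excluded as well.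

  The bound is attained by the four corners of a unit square: they are pairwise adjacent, and a
  geodesic never contains three pairwise adjacent vertices, since it has no chords.
\<close>

section \<open>Geodesics in general graphs\<close>

text \<open>A chord would allow a shortcut that skips the vertices strictly between its ends.\<close>

lemma geodesic_chordless:
  assumes p: "geodesic G p" and ik: "i < k" "k < length p" and adj: "adjacent G (p ! i) (p ! k)"
  shows "k = Suc i"
proof -
  let ?q = "take (Suc i) p @ drop k p"
  have path: "is_path G p"
    using p by (simp add: geodesic_def)
  have suc: "successively (adjacent G) (take n p)" "successively (adjacent G) (drop n p)" for n
    using path successively_append_iff[of "adjacent G" "take n p" "drop n p"]
    by (simp_all add: is_path_def)
  have last: "last (take (Suc i) p) = p ! i"
    using ik by (simp add: take_Suc_conv_app_nth)
  have "successively (adjacent G) ?q"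
    using suc adj ik by (simp add: successively_append_iff last hd_drop_conv_nth)
  moreover have "distinct ?q"
    using path ik by (simp add: is_path_def set_take_disj_set_drop_if_distinct)
  moreover have "set ?q \<subseteq> verts G"
    using path set_take_subset[of "Suc i" p] set_drop_subset[of k p]
    by (auto simp: is_path_def)
  ultimately have "is_path G ?q"
    using ik by (auto simp: is_path_def)
  moreover have "hd ?q = hd p" "last ?q = last p"
    using ik by (auto simp: hd_append)
  ultimately have "length p \<le> length ?q"
    using p unfolding geodesic_def by blast
  then show ?thesis
    using ik by simp
qed

lemma clique_general_position:
  assumes "S \<subseteq> verts G" and clique: "\<And>x y. x \<in> S \<Longrightarrow> y \<in> S \<Longrightarrow> x \<noteq> y \<Longrightarrow> adjacent G x y"
  shows "general_position G S"
proof -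
  have False
    if S: "x \<in> S" "y \<in> S" "z \<in> S" and ne: "x \<noteq> y" "y \<noteq> z" "x \<noteq> z"
      and p: "geodesic G p" "{x, y, z} \<subseteq> set p" for x y z p
  proof -
    have consecutive: "m = Suc n \<or> n = Suc m"
      if "m < length p" "n < length p" "p ! m \<in> S" "p ! n \<in> S" "p ! m \<noteq> p ! n" for m n
      using that geodesic_chordless[OF p(1), of m n] geodesic_chordless[OF p(1), of n m] clique
      by (metis linorder_neqE_nat)
    obtain i j k where ijk: "i < length p" "p ! i = x" "j < length p" "p ! j = y"
        "k < length p" "p ! k = z"
      using p(2) by (auto simp: in_set_conv_nth)
    \<comment> \<open>Three integers cannot have pairwise difference one.\<close>
    show False
      using consecutive[of i j] consecutive[of j k] consecutive[of i k] ijk S ne by auto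
  qed
  then show ?thesis
    using assms(1) unfolding general_position_def by blast
qed

text \<open>
  A potential that changes by at most one along every edge bounds distances from below, so a walk
  on which it increases by one at every step cannot be shortened.
\<close>

definition climbing :: "'a ugraph \<Rightarrow> ('a \<Rightarrow> int) \<Rightarrow> 'a list \<Rightarrow> bool" where
  "climbing G h p \<longleftrightarrow>
     p \<noteq> [] \<and> set p \<subseteq> verts G \<and> successively (\<lambda>u v. adjacent G u v \<and> h v = h u + 1) p"

lemma climbing_Cons:
  assumes "climbing G h p" "u \<in> verts G" "adjacent G u (hd p)" "h (hd p) = h u + 1"
  shows "climbing G h (u # p)"
  using assms by (auto simp: climbing_def successively_Cons)

lemma climbing_height:
  assumes "climbing G h p"
  shows "h (last p) = h (hd p) + int (length p) - 1"
proof -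
  have "successively (\<lambda>u v. adjacent G u v \<and> h v = h u + 1) p \<Longrightarrow> p \<noteq> [] \<Longrightarrow> ?thesis"
    by (induction p rule: induct_list012) auto
  then show ?thesis
    using assms by (simp add: climbing_def)
qed

lemma climbing_distinct:
  assumes "climbing G h p"
  shows "distinct p"
proof -
  have "successively (\<lambda>u v. h u < h v) p"
    by (rule successively_mono[of "\<lambda>u v. adjacent G u v \<and> h v = h u + 1"])
      (use assms in \<open>auto simp: climbing_def\<close>)
  then have "sorted_wrt (\<lambda>u v. h u < h v) p"
    by (subst (asm) successively_conv_sorted_wrt) (auto simp: transp_def)
  then show ?thesis
    by (induction p) auto
qed

lemma potential_bounds_path_length:
  assumes lip: "\<And>u v. adjacent G u v \<Longrightarrow> h v \<le> h u + (1 :: int)" and "is_path G q"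
  shows "h (last q) \<le> h (hd q) + int (length q) - 1"
proof -
  have "successively (adjacent G) q \<Longrightarrow> q \<noteq> [] \<Longrightarrow> ?thesis"
  proof (induction q rule: induct_list012)
    case (3 u v q)
    then show ?case
      using lip[of u v] by auto
  qed auto
  then show ?thesis
    using assms(2) by (simp add: is_path_def)
qed

lemma climbing_geodesic:
  assumes lip: "\<And>u v. adjacent G u v \<Longrightarrow> h v \<le> h u + 1" and p: "climbing G h p"
  shows "geodesic G p"
proof -
  have "successively (adjacent G) p"
    by (rule successively_mono[of "\<lambda>u v. adjacent G u v \<and> h v = h u + 1"])
      (use p in \<open>auto simp: climbing_def\<close>)
  then have "is_path G p"
    using p climbing_distinct[OF p] by (simp add: is_path_def climbing_def)
  moreover have "length p \<le> length q" if "is_path G q" "hd q = hd p" "last q = last p" for q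
    using potential_bounds_path_length[of G h q, OF lip that(1)] climbing_height[OF p] that by simp
  ultimately show ?thesis
    by (simp add: geodesic_def)
qed

section \<open>The two cone orders of the diagonal grid\<close>

abbreviation diagonal_grid :: "(int \<times> int) ugraph" where
  "diagonal_grid \<equiv> strong_product P_inf P_inf"

lemma verts_diagonal_grid: "verts diagonal_grid = UNIV"
  by (simp add: strong_product_def cartesian_product_def P_inf_def)

lemma adjacent_diagonal_grid:
  "adjacent diagonal_grid x y \<longleftrightarrow> x \<noteq> y \<and> \<bar>fst y - fst x\<bar> \<le> 1 \<and> \<bar>snd y - snd x\<bar> \<le> 1"
proof -
  have le_1: "\<bar>j - i\<bar> \<le> 1 \<longleftrightarrow> i = j \<or> \<bar>i - j\<bar> = 1" for i j :: int
    by arith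
  show ?thesis
    using adjacent_strong_product[of "fst x" "snd x" P_inf P_inf "fst y" "snd y"]
    unfolding le_1 adjacent_P_inf by (auto simp: verts_diagonal_grid prod_eq_iff)
qed

text \<open>
  This is meant for \<open>h = fst\<close> and \<open>h = snd\<close>: the condition on the coordinate \<open>h\<close> itself says
  \<open>h x \<le> h y\<close>, the other one bounds the sideways deviation.  Writing both in the same form
  treats the two coordinates alike.
\<close>

definition cone_le :: "(int \<times> int \<Rightarrow> int) \<Rightarrow> int \<times> int \<Rightarrow> int \<times> int \<Rightarrow> bool" where
  "cone_le h x y \<longleftrightarrow> \<bar>fst y - fst x\<bar> \<le> h y - h x \<and> \<bar>snd y - snd x\<bar> \<le> h y - h x"

lemma cone_le_antisym: "cone_le h x y \<Longrightarrow> cone_le h y x \<Longrightarrow> x = y"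
  by (auto simp: cone_le_def prod_eq_iff)

lemma cone_comparable:
  "cone_le fst x y \<or> cone_le fst y x \<or> cone_le snd x y \<or> cone_le snd y x"
  unfolding cone_le_def abs_le_iff by linarith

text \<open>
  A walk can be prolonged downwards through its cone: a king heading straight for the first vertex
  of the walk gains one unit of height per move, and stays below that vertex.
\<close>

lemma extend_climbing:
  assumes h: "h \<in> {fst, snd}" and q: "climbing diagonal_grid h q" and "cone_le h x (hd q)"
  shows "\<exists>p. climbing diagonal_grid h p \<and> hd p = x \<and> set q \<subseteq> set p"
  using assms(3)
proof (induction "nat (h (hd q) - h x)" arbitrary: x)
  case 0
  then have "x = hd q"
    by (auto simp: cone_le_def prod_eq_iff)
  then show ?case
    using q by blast
next
  case (Suc n)
  let ?y = "hd q"
  define x' where "x' = (fst x + sgn (fst ?y - fst x), snd x + sgn (snd ?y - snd x))"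
  have less: "h x < h ?y"
    using Suc.hyps(2) by simp
  have height: "h x' = h x + 1"
    using h less by (auto simp: x'_def)
  have "cone_le h x' ?y"
    using Suc.prems less height by (auto simp: cone_le_def x'_def sgn_if)
  moreover have "n = nat (h ?y - h x')"
    using Suc.hyps(2) height by simp
  ultimately obtain p where p: "climbing diagonal_grid h p" "hd p = x'" "set q \<subseteq> set p"
    using Suc.hyps(1) by blast
  have "x \<noteq> x'"
    using height by auto
  then have "adjacent diagonal_grid x x'"
    by (auto simp: adjacent_diagonal_grid x'_def sgn_if)
  then have "climbing diagonal_grid h (x # p)"
    using p height by (intro climbing_Cons) (simp_all add: verts_diagonal_grid)
  then show ?case
    using p(3) by (intro exI[of _ "x # p"]) auto
qed

lemma cone_chain_on_geodesic:
  assumes h: "h \<in> {fst, snd}" and xy: "cone_le h x y" and yz: "cone_le h y z"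
  shows "\<exists>p. geodesic diagonal_grid p \<and> {x, y, z} \<subseteq> set p"
proof -
  have "climbing diagonal_grid h [z]"
    by (simp add: climbing_def verts_diagonal_grid)
  then obtain q where q: "climbing diagonal_grid h q" "hd q = y" "z \<in> set q"
    using extend_climbing[OF h, of "[z]" y] yz by auto
  then obtain p where p: "climbing diagonal_grid h p" "hd p = x" "set q \<subseteq> set p"
    using extend_climbing[OF h q(1), of x] xy by auto
  have "x \<in> set p" "y \<in> set q"
    using p q by (auto simp: climbing_def)
  moreover have "geodesic diagonal_grid p"
    using h by (intro climbing_geodesic[OF _ p(1)]) (auto simp: adjacent_diagonal_grid)
  ultimately show ?thesis
    using p(3) q(3) by blast
qed

section \<open>The general position number\<close>

text \<open>
  Comparability in some cone order makes the two bits injective on the set: equal bits would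
  produce a third vertex below a comparable pair, which a general position set cannot contain.
\<close>

lemma diagonal_grid_general_position_bound:
  assumes S: "general_position diagonal_grid S"
  shows "finite S \<and> card S \<le> 4"
proof -
  define has_lower where "has_lower h p \<longleftrightarrow> (\<exists>r\<in>S. r \<noteq> p \<and> cone_le h r p)" for h p
  have no_chain: False
    if "h \<in> {fst, snd}" "p \<in> S" "q \<in> S" "p \<noteq> q" "cone_le h p q"
      and same: "has_lower h p = has_lower h q" for h p q
  proof -
    have "has_lower h q"
      using that unfolding has_lower_def by blast
    then obtain r where r: "r \<in> S" "r \<noteq> p" "cone_le h r p"
      using same unfolding has_lower_def by blast
    moreover have "r \<noteq> q"
      using r that cone_le_antisym by blast
    ultimately show False
      using cone_chain_on_geodesic[of h r p q] S that unfolding general_position_def by blast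
  qed
  let ?bits = "\<lambda>p. (has_lower fst p, has_lower snd p)"
  have inj: "inj_on ?bits S"
  proof (rule inj_onI, rule ccontr)
    fix p q assume "p \<in> S" "q \<in> S" "?bits p = ?bits q" "p \<noteq> q"
    then show False
      using cone_comparable[of p q] no_chain[of fst p q] no_chain[of fst q p]
        no_chain[of snd p q] no_chain[of snd q p] by auto
  qed
  have "finite S"
    using inj by (rule inj_on_finite[OF _ subset_UNIV]) simp
  moreover have "card S \<le> card (UNIV :: (bool \<times> bool) set)"
    using inj by (rule card_inj_on_le) simp_all
  ultimately show ?thesis
    by (simp add: card_UNIV_bool flip: UNIV_Times_UNIV)
qed

lemma unit_square_general_position:
  "general_position diagonal_grid ({0, 1} \<times> {0, 1})"
  by (rule clique_general_position) (auto simp: verts_diagonal_grid adjacent_diagonal_grid)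

theorem theorem3p3:
  shows "gp (strong_product P_inf P_inf) = 4"
proof -
  have "card ({0, 1 :: int} \<times> {0, 1 :: int}) = 4"
    by (simp add: card_cartesian_product)
  then have "gp diagonal_grid = enat 4"
    unfolding gp_eq_enat_iff
    using unit_square_general_position diagonal_grid_general_position_bound by blast
  then show ?thesis
    by (simp only: numeral_eq_enat)
qed

end
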